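(* For any graph $G$, we have $\mathrm{reg}(G)\leq \mathrm{im}(G)+\nabla(G)$.
   Context: $\mathrm{im}(G)$ is the induced matching number of $G$. A set $D\subseteq V(G)$ is a decycling set if $G-D$ is acyclic; $\nabla(G)$, the decycling number, is the minimum size of a decycling set. The regularity of $G$ is $\mathrm{reg}(G)=\max\{j : \widetilde{H}_{j-1}(\mathcal{I}(G)[S];\mathbf{k})\neq 0 \text{ for some } S\subseteq V(G)\}$, with $\mathcal{I}(G)$ the independence complex and $\mathbf{k}$ a fixed field. *)

theory Defs
  imports "HOL-Algebra.Elementary_Groups" "HOL-Combinatorics.Permutations"
begin

section \<open>Finite simple graphs\<close>

definition simple_graph :: "'a set \<Rightarrow> 'a set set \<Rightarrow> bool" where
  "simple_graph V E \<longleftrightarrow> finite V \<and> (\<forall>e\<in>E. e \<subseteq> V \<and> card e = 2)"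

definition induced_edges :: "'a set set \<Rightarrow> 'a set \<Rightarrow> 'a set set" where
  "induced_edges E S = {e \<in> E. e \<subseteq> S}"

definition induced_matching :: "'a set set \<Rightarrow> 'a set set \<Rightarrow> bool" where
  "induced_matching E M \<longleftrightarrow>
     M \<subseteq> E \<and> (\<forall>e\<in>M. \<forall>f\<in>M. e \<noteq> f \<longrightarrow> e \<inter> f = {}) \<and> induced_edges E (\<Union>M) = M"

definition induced_matching_number :: "'a set set \<Rightarrow> nat" where
  "induced_matching_number E = Max (card ` {M. induced_matching E M})"

definition is_cycle :: "'a set set \<Rightarrow> 'a list \<Rightarrow> bool" where
  "is_cycle E xs \<longleftrightarrow>
     3 \<le> length xs \<and> distinct xs \<and>
     (\<forall>i<length xs. {xs ! i, xs ! (Suc i mod length xs)} \<in> E)"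

definition acyclic_graph :: "'a set set \<Rightarrow> bool" where
  "acyclic_graph E \<longleftrightarrow> (\<nexists>xs. is_cycle E xs)"

definition decycling_set :: "'a set \<Rightarrow> 'a set set \<Rightarrow> 'a set \<Rightarrow> bool" where
  "decycling_set V E D \<longleftrightarrow> D \<subseteq> V \<and> acyclic_graph (induced_edges E (V - D))"

definition decycling_number :: "'a set \<Rightarrow> 'a set set \<Rightarrow> nat" where
  "decycling_number V E = Min (card ` {D. decycling_set V E D})"


section \<open>Reduced simplicial homology of finite complexes\<close>

text \<open>
  A complex is given by its set of faces, including the empty face.  A \<open>p\<close>-chain is a function
  on oriented \<open>p\<close>-simplices: \<open>c [v\<^sub>0, \<dots>, v\<^sub>p]\<close> is the coefficient of the oriented simplex
  \<open>[v\<^sub>0, \<dots>, v\<^sub>p]\<close>, so that \<open>c\<close> changes by the sign of the permutation when the vertices are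
  reordered.  No linear order on the vertices is needed.  The empty list is the oriented
  \<open>(-1)\<close>-simplex, which makes the complex the augmented one.
\<close>

definition simplicial_chains :: "'a set set \<Rightarrow> int \<Rightarrow> ('a list \<Rightarrow> 'k::field) set" where
  "simplicial_chains K p =
     {c. (\<forall>xs. c xs \<noteq> 0 \<longrightarrow> distinct xs \<and> set xs \<in> K \<and> int (length xs) = p + 1) \<and>
         (\<forall>xs \<pi>. \<pi> permutes {..<length xs} \<longrightarrow>
                  c (permute_list \<pi> xs) = of_int (sign \<pi>) * c xs)}"

text \<open>
  By the usual formula \<open>\<partial>[v\<^sub>0, \<dots>, v\<^sub>p] = (\<Sum>i\<le>p. (-1)^i [v\<^sub>0, \<dots>, v\<^sub>i\<^sub>-\<^sub>1, v\<^sub>i\<^sub>+\<^sub>1, \<dots>, v\<^sub>p])\<close>, the simplices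
  whose boundary involves \<open>[w\<^sub>1, \<dots>, w\<^sub>p]\<close> are those of the form \<open>[v, w\<^sub>1, \<dots>, w\<^sub>p]\<close> up to
  orientation, and in this orientation the face \<open>[w\<^sub>1, \<dots>, w\<^sub>p]\<close> arises for \<open>i = 0\<close>, with
  coefficient \<open>1\<close>.  This gives the coefficients of \<open>\<partial> c\<close>.
\<close>

definition simplicial_boundary ::
  "'a set set \<Rightarrow> ('a list \<Rightarrow> 'k::field) \<Rightarrow> 'a list \<Rightarrow> 'k" where
  "simplicial_boundary K c = (\<lambda>ws. \<Sum>v\<in>\<Union>K. c (v # ws))"

definition simplicial_cycles :: "'a set set \<Rightarrow> int \<Rightarrow> ('a list \<Rightarrow> 'k::field) set" where
  "simplicial_cycles K p = {c \<in> simplicial_chains K p. simplicial_boundary K c = (\<lambda>_. 0)}"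

definition simplicial_boundaries :: "'a set set \<Rightarrow> int \<Rightarrow> ('a list \<Rightarrow> 'k::field) set" where
  "simplicial_boundaries K p = simplicial_boundary K ` simplicial_chains K (p + 1)"

definition cycle_group :: "'a set set \<Rightarrow> int \<Rightarrow> ('a list \<Rightarrow> 'k::field) monoid" where
  "cycle_group K p =
     \<lparr>carrier = simplicial_cycles K p, monoid.mult = (\<lambda>c d xs. c xs + d xs), one = (\<lambda>_. 0)\<rparr>"

definition reduced_homology :: "'a set set \<Rightarrow> int \<Rightarrow> ('a list \<Rightarrow> 'k::field) set monoid" where
  "reduced_homology K p = cycle_group K p Mod simplicial_boundaries K p"


lemma permute_list_Cons:
  assumes "\<pi> permutes {..<length ws}"
  obtains \<rho> where "\<rho> permutes {..<length (v # ws)}" "sign \<rho> = sign \<pi>"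
    "v # permute_list \<pi> ws = permute_list \<rho> (v # ws)"
proof
  let ?\<rho> = "map_permutation {..<length ws} Suc \<pi>"
  have perm: "?\<rho> permutes {1..<Suc (length ws)}"
  proof (rule map_permutation_permutes[OF _ assms])
    show "bij_betw Suc {..<length ws} {1..<Suc (length ws)}"
      by (auto simp: bij_betw_def lessThan_atLeast0 image_Suc_atLeastLessThan)
  qed
  show perm': "?\<rho> permutes {..<length (v # ws)}"
    by (rule permutes_subset[OF perm]) auto
  show "sign ?\<rho> = sign \<pi>"
    by (rule sign_map_permutation) (use assms in auto)
  show "v # permute_list \<pi> ws = permute_list ?\<rho> (v # ws)"
  proof (rule nth_equalityI)
    fix i assume i: "i < length (v # permute_list \<pi> ws)"
    show "(v # permute_list \<pi> ws) ! i = permute_list ?\<rho> (v # ws) ! i"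
    proof (cases i)
      case 0
      have "?\<rho> 0 = 0"
        using perm by (rule permutes_not_in) auto
      then show ?thesis
        using 0 perm' permute_list_nth[of ?\<rho> "v # ws" 0] by simp
    next
      case (Suc j)
      then have j: "j < length ws" using i by simp
      have "?\<rho> (Suc j) = Suc (\<pi> j)"
        by (rule map_permutation_apply) (use j in auto)
      then show ?thesis
        using Suc j perm' permute_list_nth[of ?\<rho> "v # ws" "Suc j"] permute_list_nth[OF assms j]
        by simp
    qed
  qed auto
qed

lemma simplicial_boundary_in_chains:
  assumes K: "\<And>A B. A \<in> K \<Longrightarrow> B \<subseteq> A \<Longrightarrow> B \<in> K" and c: "c \<in> simplicial_chains K (p + 1)"
  shows "simplicial_boundary K c \<in> simplicial_chains K p"
proof -
  have "distinct ws \<and> set ws \<in> K \<and> int (length ws) = p + 1"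
    if "simplicial_boundary K c ws \<noteq> 0" for ws
  proof -
    have "\<exists>v. c (v # ws) \<noteq> 0"
      by (rule ccontr) (use that in \<open>simp add: simplicial_boundary_def\<close>)
    then obtain v where "c (v # ws) \<noteq> 0" ..
    then have "distinct (v # ws)" "set (v # ws) \<in> K" "int (length (v # ws)) = p + 1 + 1"
      using c unfolding simplicial_chains_def by blast+
    then show ?thesis
      using K[of "set (v # ws)" "set ws"] by auto
  qed
  moreover have "simplicial_boundary K c (permute_list \<pi> ws)
      = of_int (sign \<pi>) * simplicial_boundary K c ws"
    if "\<pi> permutes {..<length ws}" for \<pi> ws
  proof -
    have "c (v # permute_list \<pi> ws) = of_int (sign \<pi>) * c (v # ws)" for v
    proof -
      obtain \<rho> where "\<rho> permutes {..<length (v # ws)}" "sign \<rho> = sign \<pi>"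
        "v # permute_list \<pi> ws = permute_list \<rho> (v # ws)"
        using \<open>\<pi> permutes {..<length ws}\<close> by (rule permute_list_Cons)
      moreover from this(1) have "c (permute_list \<rho> (v # ws)) = of_int (sign \<rho>) * c (v # ws)"
        using c unfolding simplicial_chains_def by blast
      ultimately show ?thesis by simp
    qed
    then show ?thesis
      by (simp add: simplicial_boundary_def sum_distrib_left)
  qed
  ultimately show ?thesis
    unfolding simplicial_chains_def by blast
qed

lemma simplicial_chains_swap:
  assumes c: "c \<in> simplicial_chains K p"
  shows "c (v # u # ws) = - c (u # v # ws)"
proof -
  let ?\<pi> = "Transposition.transpose 0 (1::nat)"
  have perm: "?\<pi> permutes {..<length (u # v # ws)}"
    by (rule permutes_swap_id) auto
  have "permute_list ?\<pi> (u # v # ws) = v # u # ws"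
  proof (rule nth_equalityI)
    fix i assume "i < length (permute_list ?\<pi> (u # v # ws))"
    then show "permute_list ?\<pi> (u # v # ws) ! i = (v # u # ws) ! i"
      using permute_list_nth[OF perm, of i]
      by (cases i; cases "i - 1") (auto simp: Transposition.transpose_def)
  qed simp
  moreover have "c (permute_list ?\<pi> (u # v # ws)) = of_int (sign ?\<pi>) * c (u # v # ws)"
    using c perm unfolding simplicial_chains_def by blast
  ultimately show ?thesis
    by (simp add: sign_swap_id)
qed

lemma simplicial_boundary_boundary:
  assumes c: "c \<in> simplicial_chains K p"
  shows "simplicial_boundary K (simplicial_boundary K c) = (\<lambda>_. 0)"
proof
  fix ws
  show "simplicial_boundary K (simplicial_boundary K c) ws = 0"
  proof (cases "finite (\<Union>K)")
    case True
    have nodiag: "c (v # v # ws) = 0" for v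
      using c unfolding simplicial_chains_def by fastforce
    have "(\<Sum>v\<in>W. \<Sum>u\<in>W. c (u # v # ws)) = 0" if "finite W" for W
      using that
    proof (induction W)
      case (insert x W)
      have "(\<Sum>v\<in>W. c (x # v # ws)) = (\<Sum>v\<in>W. - c (v # x # ws))"
        by (rule sum.cong[OF refl]) (rule simplicial_chains_swap[OF c])
      then show ?case
        using insert by (simp add: sum.distrib nodiag sum_negf)
    qed simp
    then show ?thesis
      using True by (simp add: simplicial_boundary_def)
  qed (simp add: simplicial_boundary_def)
qed

lemma simplicial_chains_zero: "(\<lambda>_. 0) \<in> simplicial_chains K p"
  by (simp add: simplicial_chains_def)

lemma simplicial_chains_uminus:
  assumes "c \<in> simplicial_chains K p"
  shows "(\<lambda>xs. - c xs) \<in> simplicial_chains K p"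
  using assms by (simp add: simplicial_chains_def)

lemma simplicial_chains_add:
  assumes c: "c \<in> simplicial_chains K p" and d: "d \<in> simplicial_chains K p"
  shows "(\<lambda>xs. c xs + d xs) \<in> simplicial_chains K p"
proof -
  have "distinct xs \<and> set xs \<in> K \<and> int (length xs) = p + 1" if "c xs + d xs \<noteq> 0" for xs
  proof -
    have "c xs \<noteq> 0 \<or> d xs \<noteq> 0" using that by auto
    then show ?thesis using c d unfolding simplicial_chains_def by blast
  qed
  moreover have "c (permute_list \<pi> xs) + d (permute_list \<pi> xs) = of_int (sign \<pi>) * (c xs + d xs)"
    if "\<pi> permutes {..<length xs}" for \<pi> xs
    using that c d by (simp add: simplicial_chains_def distrib_left)
  ultimately show ?thesis unfolding simplicial_chains_def by blast
qed

lemma simplicial_boundary_uminus: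
  "simplicial_boundary K (\<lambda>xs. - c xs) = (\<lambda>xs. - simplicial_boundary K c xs)"
  by (simp add: simplicial_boundary_def sum_negf)

lemma simplicial_boundary_add:
  "simplicial_boundary K (\<lambda>xs. c xs + d xs)
     = (\<lambda>xs. simplicial_boundary K c xs + simplicial_boundary K d xs)"
  by (simp add: simplicial_boundary_def sum.distrib)

lemma comm_group_cycle_group:
  "comm_group (cycle_group K p :: ('a list \<Rightarrow> 'k::field) monoid)" (is "comm_group ?G")
proof (rule comm_groupI)
  fix c assume c: "c \<in> carrier ?G"
  then have "(\<lambda>xs. - c xs) \<in> carrier ?G"
    by (simp add: cycle_group_def simplicial_cycles_def simplicial_chains_uminus
        simplicial_boundary_uminus)
  then show "\<exists>d\<in>carrier ?G. d \<otimes>\<^bsub>?G\<^esub> c = \<one>\<^bsub>?G\<^esub>"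
    by (rule bexI[rotated]) (simp add: cycle_group_def)
next
  show "\<one>\<^bsub>?G\<^esub> \<in> carrier ?G"
    by (simp add: cycle_group_def simplicial_cycles_def simplicial_chains_zero
        simplicial_boundary_def)
next
  fix c d assume "c \<in> carrier ?G" "d \<in> carrier ?G"
  then show "c \<otimes>\<^bsub>?G\<^esub> d \<in> carrier ?G"
    by (simp add: cycle_group_def simplicial_cycles_def simplicial_chains_add
        simplicial_boundary_add)
qed (simp_all add: cycle_group_def add_ac)

lemma comm_group_reduced_homology:
  assumes K: "\<And>A B. A \<in> K \<Longrightarrow> B \<subseteq> A \<Longrightarrow> B \<in> K"
  shows "comm_group (reduced_homology K p :: ('a list \<Rightarrow> 'k::field) set monoid)"
proof -
  interpret Z: comm_group "cycle_group K p :: ('a list \<Rightarrow> 'k) monoid"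
    by (rule comm_group_cycle_group)
  let ?C = "simplicial_chains K (p + 1) :: ('a list \<Rightarrow> 'k) set"
  have "subgroup (simplicial_boundaries K p) (cycle_group K p :: ('a list \<Rightarrow> 'k) monoid)"
  proof (rule Z.subgroupI)
    show sub: "simplicial_boundaries K p \<subseteq> carrier (cycle_group K p :: ('a list \<Rightarrow> 'k) monoid)"
    proof
      fix b :: "'a list \<Rightarrow> 'k" assume "b \<in> simplicial_boundaries K p"
      then obtain c where c: "c \<in> ?C" "b = simplicial_boundary K c"
        by (auto simp: simplicial_boundaries_def)
      then show "b \<in> carrier (cycle_group K p)"
        using simplicial_boundary_in_chains[OF K c(1)] simplicial_boundary_boundary[OF c(1)]
        by (simp add: cycle_group_def simplicial_cycles_def)
    qed
    have "(\<lambda>_. 0) \<in> ?C"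
      by (rule simplicial_chains_zero)
    then show "simplicial_boundaries K p \<noteq> ({} :: ('a list \<Rightarrow> 'k) set)"
      unfolding simplicial_boundaries_def by blast
    show "inv\<^bsub>cycle_group K p\<^esub> b \<in> simplicial_boundaries K p"
      if b: "b \<in> simplicial_boundaries K p" for b :: "'a list \<Rightarrow> 'k"
    proof -
      obtain c where c: "c \<in> ?C" "b = simplicial_boundary K c"
        using b by (auto simp: simplicial_boundaries_def)
      have nb: "(\<lambda>xs. - b xs) = simplicial_boundary K (\<lambda>xs. - c xs)"
        by (simp add: c simplicial_boundary_uminus)
      then have nb': "(\<lambda>xs. - b xs) \<in> simplicial_boundaries K p"
        using simplicial_chains_uminus[OF c(1)] by (auto simp: simplicial_boundaries_def)
      have "inv\<^bsub>cycle_group K p\<^esub> b = (\<lambda>xs. - b xs)"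
        by (rule Z.inv_equality) (use sub b nb' in \<open>auto simp: cycle_group_def\<close>)
      then show ?thesis using nb' by simp
    qed
    show "a \<otimes>\<^bsub>cycle_group K p\<^esub> b \<in> simplicial_boundaries K p"
      if ab: "a \<in> simplicial_boundaries K p" "b \<in> simplicial_boundaries K p"
      for a b :: "'a list \<Rightarrow> 'k"
    proof -
      obtain c d where c: "c \<in> ?C" "a = simplicial_boundary K c"
        and d: "d \<in> ?C" "b = simplicial_boundary K d"
        using ab by (auto simp: simplicial_boundaries_def)
      have "a \<otimes>\<^bsub>cycle_group K p\<^esub> b = simplicial_boundary K (\<lambda>xs. c xs + d xs)"
        by (simp add: c d cycle_group_def simplicial_boundary_add)
      then show ?thesis
        using simplicial_chains_add[OF c(1) d(1)] by (auto simp: simplicial_boundaries_def)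
    qed
  qed
  then show ?thesis
    unfolding reduced_homology_def by (rule Z.abelian_FactGroup)
qed


section \<open>Independence complex and regularity\<close>

definition independence_complex :: "'a set \<Rightarrow> 'a set set \<Rightarrow> 'a set set" where
  "independence_complex V E = {A. A \<subseteq> V \<and> (\<forall>e\<in>E. \<not> e \<subseteq> A)}"

definition induced_subcomplex :: "'a set set \<Rightarrow> 'a set \<Rightarrow> 'a set set" where
  "induced_subcomplex K S = {A \<in> K. A \<subseteq> S}"

definition regularity :: "'k::field itself \<Rightarrow> 'a set \<Rightarrow> 'a set set \<Rightarrow> nat" where
  "regularity _ V E =
     Max {j. \<exists>S\<subseteq>V. \<not> trivial_group
                (reduced_homology (induced_subcomplex (independence_complex V E) S) (int j - 1)
                   :: ('a list \<Rightarrow> 'k) set monoid)}"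

end

theory Submission
  imports Defs
begin

text \<open>
  For a vertex \<open>v\<close> of a complex \<open>K\<close>, the homology of \<open>K\<close> vanishes in degree \<open>p\<close> if that of the
  deletion of \<open>v\<close> vanishes in degree \<open>p\<close> and that of its link in degree \<open>p - 1\<close>.  For independence
  complexes, deletion and link of \<open>v\<close> are the complexes of \<open>G - v\<close> and \<open>G - N[v]\<close>.  Removing the
  vertices of a decycling set one by one, each at the cost of one degree, leaves a forest.  In a
  forest, take \<open>v\<close> to be the neighbour of a leaf \<open>x\<close>: then \<open>x\<close> is isolated in \<open>G - v\<close>, whose complex
  is a cone, and an induced matching of \<open>G - N[v]\<close> extends by the edge \<open>xv\<close>, so that passing to the
  link also decreases the induced matching number.
\<close>

section \<open>Alternating functions on lists\<close>

text \<open>Adjacent transpositions generate all permutations, and this local form of the sign rule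
  fits recursion on lists. In characteristic 2 it does not force the value 0 on lists with repeated
  entries; for chains that comes from the condition on the support.\<close>

definition alternating :: "('a list \<Rightarrow> 'k::field) \<Rightarrow> bool" where
  "alternating c \<longleftrightarrow> (\<forall>ys a b zs. c (ys @ a # b # zs) = - c (ys @ b # a # zs))"

lemma alternatingD: "alternating c \<Longrightarrow> c (ys @ a # b # zs) = - c (ys @ b # a # zs)"
  unfolding alternating_def by blast

lemma alternating_Cons: "alternating c \<Longrightarrow> alternating (\<lambda>ys. c (x # ys))"
  unfolding alternating_def by (metis append_Cons)

text \<open>Moving \<open>a\<close> to the right past \<open>ms\<close>, exchanging it with
  \<open>b\<close> and moving \<open>b\<close> back takes an odd number of adjacent swaps.\<close>

lemma alternating_swap:
  assumes "alternating c"
  shows "c (ys @ a # ms @ b # zs) = - c (ys @ b # ms @ a # zs)"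
proof (induction ms arbitrary: ys)
  case Nil
  show ?case using alternatingD[OF assms, of ys a b zs] by simp
next
  case (Cons m ms)
  have "c (ys @ a # (m # ms) @ b # zs) = - c ((ys @ [m]) @ a # ms @ b # zs)"
    using alternatingD[OF assms, of ys a m] by simp
  also have "\<dots> = c (ys @ m # b # ms @ a # zs)"
    by (subst Cons.IH) simp
  also have "\<dots> = - c (ys @ b # (m # ms) @ a # zs)"
    using alternatingD[OF assms, of ys m b] by simp
  finally show ?case .
qed

lemma permute_list_transpose:
  assumes "i < length xs" "j < length xs"
  shows "permute_list (Transposition.transpose i j) xs = xs[i := xs ! j, j := xs ! i]"
proof (rule nth_equalityI)
  fix k assume k: "k < length (permute_list (Transposition.transpose i j) xs)"
  have "Transposition.transpose i j permutes {..<length xs}"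
    by (rule permutes_swap_id) (use assms in auto)
  then show "permute_list (Transposition.transpose i j) xs ! k = xs[i := xs ! j, j := xs ! i] ! k"
    using k assms by (auto simp: permute_list_nth nth_list_update Transposition.transpose_def)
qed simp

lemma alternating_transpose:
  assumes c: "alternating c" and ij: "i < j" "j < length xs"
  shows "c (permute_list (Transposition.transpose i j) xs) = - c xs"
proof -
  define ys ms zs where "ys = take i xs" and "ms = take (j - Suc i) (drop (Suc i) xs)"
    and "zs = drop (Suc j) xs"
  have "drop (Suc i) xs = ms @ drop (j - Suc i) (drop (Suc i) xs)"
    unfolding ms_def by (rule append_take_drop_id[symmetric])
  also have "drop (j - Suc i) (drop (Suc i) xs) = xs ! j # zs"
    using ij by (simp add: zs_def Cons_nth_drop_Suc)
  finally have xs: "xs = ys @ xs ! i # ms @ xs ! j # zs"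
    using ij by (metis append_take_drop_id id_take_nth_drop less_trans ys_def)
  have i: "i = length ys" and j: "j = length ys + Suc (length ms)"
    using ij by (auto simp: ys_def ms_def)
  have "(ys @ a # ms @ b # zs)[i := b, j := a] = ys @ b # ms @ a # zs" for a b
    unfolding j unfolding i by (simp add: list_update_append)
  from this[of "xs ! i" "xs ! j"]
  have "xs[i := xs ! j, j := xs ! i] = ys @ xs ! j # ms @ xs ! i # zs"
    by (simp only: xs[symmetric])
  then have "permute_list (Transposition.transpose i j) xs = ys @ xs ! j # ms @ xs ! i # zs"
    using ij by (simp only: permute_list_transpose less_trans[OF ij])
  then have "c (permute_list (Transposition.transpose i j) xs) = c (ys @ xs ! j # ms @ xs ! i # zs)"
    by (rule arg_cong)
  also have "\<dots> = - c (ys @ xs ! i # ms @ xs ! j # zs)"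
    by (rule alternating_swap[OF c])
  finally show ?thesis
    by (simp only: xs[symmetric])
qed

lemma alternating_permute_list:
  fixes c :: "'a list \<Rightarrow> 'k::field"
  assumes c: "alternating c" and "\<pi> permutes {..<length xs}"
  shows "c (permute_list \<pi> xs) = of_int (sign \<pi>) * c xs"
proof -
  \<comment> \<open>The list is generalised because \<open>permute_list\<close> of a composition
    applies the induction hypothesis to an already transposed list.\<close>
  have "\<forall>ys. length ys = length xs \<longrightarrow> c (permute_list \<pi> ys) = of_int (sign \<pi>) * c ys"
    using assms(2) finite_lessThan
  proof (induction rule: permutes_induct)
    case (swap i j p)
    show ?case
    proof (intro allI impI)
      fix ys :: "'a list" assume l: "length ys = length xs"
      have "c (permute_list (Transposition.transpose i j) ys) = - c ys"
      proof (cases "i < j")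
        case True
        then show ?thesis using swap l by (intro alternating_transpose[OF c]) auto
      next
        case False
        then show ?thesis
          using swap l alternating_transpose[OF c, of j i ys] by (simp add: transpose_commute)
      qed
      moreover have "permutation p"
        using swap permutation_permutes by blast
      ultimately show "c (permute_list (Transposition.transpose i j \<circ> p) ys)
          = of_int (sign (Transposition.transpose i j \<circ> p)) * c ys"
        using swap l by (simp add: permute_list_compose sign_compose permutation_swap_id sign_swap_id)
    qed
  qed simp
  then show ?thesis by blast
qed

lemma alternating_simplicial_chain:
  fixes c :: "'a list \<Rightarrow> 'k::field"
  assumes c: "c \<in> simplicial_chains K p"
  shows "alternating c"
  unfolding alternating_def
proof (intro allI)
  fix ys zs :: "'a list" and a b
  let ?xs = "ys @ a # b # zs" and ?t = "Transposition.transpose (length ys) (Suc (length ys))"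
  have "?t permutes {..<length ?xs}"
    by (rule permutes_swap_id) auto
  then have "c (permute_list ?t ?xs) = of_int (sign ?t) * c ?xs"
    using c unfolding simplicial_chains_def by blast
  moreover have "permute_list ?t ?xs = ys @ b # a # zs"
    by (subst permute_list_transpose) (auto simp: list_update_append nth_append)
  ultimately show "c ?xs = - c (ys @ b # a # zs)"
    by (simp add: sign_swap_id)
qed

text \<open>With the sign rule reduced to adjacent swaps, functions defined by recursion, such as
  \<open>cone\<close>, are easily shown to be chains.\<close>

lemma simplicial_chains_iff:
  "c \<in> simplicial_chains K p \<longleftrightarrow>
     (\<forall>xs. c xs \<noteq> 0 \<longrightarrow> distinct xs \<and> set xs \<in> K \<and> int (length xs) = p + 1) \<and> alternating c"
  using alternating_simplicial_chain[of c K p] alternating_permute_list[of c]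
  unfolding simplicial_chains_def by blast

text \<open>An occurrence of \<open>v\<close> can be swapped with the first entry, at the cost of a
  sign only.\<close>

lemma alternating_eq_0:
  assumes c: "alternating c" and 0: "\<And>zs. c (v # zs) = 0" and "v \<in> set xs"
  shows "c xs = 0"
proof -
  have "c (ys @ v # zs) = 0" for ys zs
  proof (cases ys)
    case (Cons y ys')
    then show ?thesis
      using alternating_swap[OF c, of "[]" y ys' v zs] 0 by simp
  qed (simp add: 0)
  then show ?thesis
    using \<open>v \<in> set xs\<close> by (metis split_list)
qed


section \<open>Cones over chains\<close>

text \<open>
  If \<open>v\<close> occurs once in \<open>xs\<close>, at position \<open>i\<close>, and \<open>d\<close> vanishes on lists containing \<open>v\<close>, then
  \<open>cone v d xs\<close> is \<open>(-1)^i\<close> times the value of \<open>d\<close> on \<open>xs\<close> without \<open>v\<close>.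
\<close>

fun cone :: "'a \<Rightarrow> ('a list \<Rightarrow> 'k::field) \<Rightarrow> 'a list \<Rightarrow> 'k" where
  "cone v d [] = 0"
| "cone v d (x # xs) = (if x = v then d xs else 0) - cone v (\<lambda>ys. d (x # ys)) xs"

lemma cone_zero [simp]: "cone v (\<lambda>_. 0) xs = 0"
  by (induction xs) auto

lemma cone_uminus: "cone v (\<lambda>ys. - d ys) xs = - cone v d xs"
  by (induction xs arbitrary: d) auto

lemma cone_add: "cone v (\<lambda>ys. c ys + d ys) xs = cone v c xs + cone v d xs"
  by (induction xs arbitrary: c d) auto

lemma cone_sum:
  "finite W \<Longrightarrow> cone v (\<lambda>ys. \<Sum>w\<in>W. d w ys) xs = (\<Sum>w\<in>W. cone v (d w) xs)"
  by (induction W rule: finite_induct) (auto simp: cone_add)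

text \<open>If \<open>v\<close> is one of the two swapped entries, its position changes by one,
  which flips the sign of the term removing it; all other terms change sign because \<open>d\<close>
  is alternating.\<close>

lemma alternating_cone:
  assumes "alternating d"
  shows "alternating (cone v d)"
proof -
  have "cone v d (ys @ a # b # zs) = - cone v d (ys @ b # a # zs)"
    if "alternating d" for d :: "'a list \<Rightarrow> 'k::field" and ys a b zs
    using that
  proof (induction ys arbitrary: d)
    case Nil
    have "(\<lambda>ys. d (a # b # ys)) = (\<lambda>ys. - d (b # a # ys))"
      using alternatingD[OF Nil, of "[]" a b] by auto
    then show ?case by (simp add: cone_uminus)
  next
    case (Cons y ys)
    show ?case
      using Cons.IH[OF alternating_Cons[OF Cons.prems, of y]]
        alternatingD[OF Cons.prems, of ys a b zs] by simp
  qed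
  then show ?thesis
    using assms unfolding alternating_def[of "cone v d"] by blast
qed

lemma cone_nonzeroE:
  assumes "cone v d xs \<noteq> 0"
  obtains ys zs where "xs = ys @ v # zs" "d (ys @ zs) \<noteq> 0"
proof -
  have "\<exists>ys zs. xs = ys @ v # zs \<and> d (ys @ zs) \<noteq> 0"
    using assms
  proof (induction xs arbitrary: d)
    case (Cons x xs)
    show ?case
    proof (cases "x = v \<and> d xs \<noteq> 0")
      case True
      then show ?thesis by (intro exI[of _ "[]"] exI[of _ xs]) simp
    next
      case False
      then have "cone v (\<lambda>ys. d (x # ys)) xs \<noteq> 0"
        using Cons.prems by (auto split: if_splits)
      from Cons.IH[OF this] obtain ys zs where "xs = ys @ v # zs" "d (x # ys @ zs) \<noteq> 0"
        by blast
      then show ?thesis by (intro exI[of _ "x # ys"] exI[of _ zs]) simp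
    qed
  qed simp
  then show thesis using that by blast
qed


section \<open>Deletion and link of a vertex\<close>

locale finite_complex =
  fixes K :: "'a set set"
  assumes finite_vertices: "finite (\<Union>K)"
    and face_subset: "A \<in> K \<Longrightarrow> B \<subseteq> A \<Longrightarrow> B \<in> K"

definition deletion :: "'a set set \<Rightarrow> 'a \<Rightarrow> 'a set set" where
  "deletion K v = {A \<in> K. v \<notin> A}"

definition link :: "'a set set \<Rightarrow> 'a \<Rightarrow> 'a set set" where
  "link K v = {A. v \<notin> A \<and> insert v A \<in> K}"

text \<open>Elementwise form of a trivial homology group, so that arguments take place on chains and
  not on cosets. The type argument fixes the field, which the type of the complex does not
  mention.\<close>

definition homology_vanishes :: "'k::field itself \<Rightarrow> 'a set set \<Rightarrow> int \<Rightarrow> bool" where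
  "homology_vanishes _ K p \<longleftrightarrow>
     (simplicial_cycles K p :: ('a list \<Rightarrow> 'k) set) \<subseteq> simplicial_boundaries K p"

lemma simplicial_chainsD:
  assumes "c \<in> simplicial_chains K p" "c xs \<noteq> 0"
  shows "distinct xs" "set xs \<in> K" "int (length xs) = p + 1"
  using assms by (auto simp: simplicial_chains_iff)

lemma simplicial_chains_mono: "L \<subseteq> K \<Longrightarrow> simplicial_chains L p \<subseteq> simplicial_chains K p"
  by (auto simp: simplicial_chains_iff) blast

lemma simplicial_chains_diff:
  assumes "c \<in> simplicial_chains K p" "d \<in> simplicial_chains K p"
  shows "(\<lambda>xs. c xs - d xs) \<in> simplicial_chains K p"
  using simplicial_chains_add[OF assms(1) simplicial_chains_uminus[OF assms(2)]] by simp

lemma simplicial_boundary_diff: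
  "simplicial_boundary K (\<lambda>xs. c xs - d xs)
     = (\<lambda>xs. simplicial_boundary K c xs - simplicial_boundary K d xs)"
  by (simp add: simplicial_boundary_def sum_subtractf)

text \<open>The sum defining the boundary runs over the vertices of the given complex; vertices
  outside \<open>L\<close> lie in no face of \<open>L\<close> and contribute 0. Hence all boundaries
  can be computed in \<open>K\<close>.\<close>

lemma simplicial_boundary_subcomplex:
  assumes "L \<subseteq> K" "finite (\<Union>K)" "c \<in> simplicial_chains L p"
  shows "simplicial_boundary L c = simplicial_boundary K c"
proof
  fix ws
  show "simplicial_boundary L c ws = simplicial_boundary K c ws"
    unfolding simplicial_boundary_def
  proof (rule sum.mono_neutral_left)
    show "\<forall>i\<in>\<Union> K - \<Union> L. c (i # ws) = 0"
      using simplicial_chainsD(2)[OF assms(3)] by fastforce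
  qed (use assms in auto)
qed

context finite_complex
begin

lemma deletion_subset: "deletion K v \<subseteq> K"
  by (auto simp: deletion_def)

lemma link_subset: "link K v \<subseteq> K"
  using face_subset by (auto simp: link_def)

lemma link_subset_deletion: "link K v \<subseteq> deletion K v"
  using link_subset[of v] by (auto simp: link_def deletion_def)

text \<open>The cone homotopy formula. In the sum over the new first vertex \<open>u\<close>, the
  first term of the recursion for \<open>cone\<close> survives only for \<open>u = v\<close>, and by
  linearity the second terms add up to the cone over the boundary.\<close>

lemma boundary_cone:
  assumes v: "{v} \<in> K"
  shows "simplicial_boundary K (cone v d) ws = d ws - cone v (simplicial_boundary K d) ws"
proof -
  have "simplicial_boundary K (cone v d) ws
      = (\<Sum>u\<in>\<Union>K. if u = v then d ws else 0) - (\<Sum>u\<in>\<Union>K. cone v (\<lambda>ys. d (u # ys)) ws)"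
    by (simp add: simplicial_boundary_def sum_subtractf)
  also have "(\<Sum>u\<in>\<Union>K. if u = v then d ws else 0) = d ws"
  proof -
    have "v \<in> \<Union>K" using v by auto
    then show ?thesis using finite_vertices by (simp del: Union_iff)
  qed
  also have "(\<Sum>u\<in>\<Union>K. cone v (\<lambda>ys. d (u # ys)) ws) = cone v (simplicial_boundary K d) ws"
    unfolding simplicial_boundary_def by (rule cone_sum[OF finite_vertices, symmetric])
  finally show ?thesis .
qed

lemma cone_chain:
  assumes d: "d \<in> simplicial_chains (link K v) p"
  shows "cone v d \<in> simplicial_chains K (p + 1)"
  unfolding simplicial_chains_iff
proof (intro conjI allI impI)
  show "alternating (cone v d)"
    by (rule alternating_cone[OF alternating_simplicial_chain[OF d]])
  fix xs assume "cone v d xs \<noteq> 0"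
  then obtain ys zs where xs: "xs = ys @ v # zs" "d (ys @ zs) \<noteq> 0"
    by (rule cone_nonzeroE)
  from simplicial_chainsD[OF d this(2)]
  show "distinct xs" "set xs \<in> K" "int (length xs) = p + 1 + 1"
    by (auto simp: xs link_def)
qed

section \<open>Splitting a chain into its parts through and away from a vertex\<close>

context
  fixes c :: "'a list \<Rightarrow> 'k::field" and p :: int and v :: 'a
  assumes c: "c \<in> simplicial_chains K p"
begin

lemma link_part_chain: "(\<lambda>ws. c (v # ws)) \<in> simplicial_chains (link K v) (p - 1)"
proof -
  have "distinct ws \<and> set ws \<in> link K v \<and> int (length ws) = p - 1 + 1" if "c (v # ws) \<noteq> 0" for ws
    using simplicial_chainsD[OF c that] by (auto simp: link_def)
  then show ?thesis
    using alternating_Cons[OF alternating_simplicial_chain[OF c]] by (simp add: simplicial_chains_iff)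
qed

text \<open>The sign comes from swapping \<open>v\<close> with the vertex over which the boundary
  sums. In particular the link part of a cycle is a cycle.\<close>

lemma boundary_link_part:
  "simplicial_boundary K (\<lambda>ws. c (v # ws)) = (\<lambda>ws. - simplicial_boundary K c (v # ws))"
proof
  fix ws
  show "simplicial_boundary K (\<lambda>ws. c (v # ws)) ws = - simplicial_boundary K c (v # ws)"
    unfolding simplicial_boundary_def sum_negf[symmetric]
    by (rule sum.cong[OF refl]) (rule simplicial_chains_swap[OF c])
qed

lemma deletion_part_chain:
  "(\<lambda>xs. c xs - cone v (\<lambda>ws. c (v # ws)) xs) \<in> simplicial_chains (deletion K v) p" (is "?d \<in> _")
proof -
  have K: "?d \<in> simplicial_chains K p"
    using simplicial_chains_diff[OF c] cone_chain[OF link_part_chain] by simp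
  \<comment> \<open>On lists starting with \<open>v\<close> the first term of the cone cancels
    \<open>c\<close>, and its recursive term involves only these values.\<close>
  have "c (v # v # zs) = 0" for zs
    using simplicial_chainsD(1)[OF c, of "v # v # zs"] by auto
  then have "?d (v # zs) = 0" for zs
    by simp
  then have "?d xs = 0" if "v \<in> set xs" for xs
    using alternating_eq_0[OF alternating_simplicial_chain[OF K]] that by blast
  then show ?thesis
    using K unfolding simplicial_chains_iff deletion_def by blast
qed

end

text \<open>This is exactness of H_p(deletion) \<rightarrow> H_p(K) \<rightarrow> H_{p-1}(link) at
  the middle term, carried out on chains: the link part \<open>b\<close> of a cycle bounds some
  \<open>d\<close>, and the cone over \<open>d\<close> moves the cycle into the deletion.\<close>

lemma homology_vanishes_deletion_link:
  assumes v: "{v} \<in> K"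
    and del: "homology_vanishes TYPE('k::field) (deletion K v) p"
    and link: "homology_vanishes TYPE('k) (link K v) (p - 1)"
  shows "homology_vanishes TYPE('k) K p"
  unfolding homology_vanishes_def
proof
  fix c :: "'a list \<Rightarrow> 'k" assume "c \<in> simplicial_cycles K p"
  then have c: "c \<in> simplicial_chains K p" and dc: "simplicial_boundary K c = (\<lambda>_. 0)"
    by (auto simp: simplicial_cycles_def)
  define b where "b = (\<lambda>ws. c (v # ws))"
  have b: "b \<in> simplicial_chains (link K v) (p - 1)"
    unfolding b_def by (rule link_part_chain[OF c])
  have "simplicial_boundary (link K v) b = (\<lambda>_. 0)"
    unfolding simplicial_boundary_subcomplex[OF link_subset finite_vertices b]
    unfolding b_def boundary_link_part[OF c] by (simp add: dc)
  then have "b \<in> simplicial_boundaries (link K v) (p - 1)"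
    using b link by (auto simp: homology_vanishes_def simplicial_cycles_def)
  then obtain d where d: "d \<in> simplicial_chains (link K v) p" and bd: "b = simplicial_boundary K d"
    using simplicial_boundary_subcomplex[OF link_subset finite_vertices]
    by (auto simp: simplicial_boundaries_def)
  have cone_d: "cone v d \<in> simplicial_chains K (p + 1)"
    by (rule cone_chain[OF d])
  have d_cone: "simplicial_boundary K (cone v d) = (\<lambda>ws. d ws - cone v b ws)"
    using boundary_cone[OF v] bd by auto
  \<comment> \<open>Homologous to \<open>c\<close>. The boundary of the cone is \<open>d\<close>
    minus the cone over \<open>b\<close>, so the part of \<open>c\<close> through \<open>v\<close>
    is replaced by \<open>d\<close>, which avoids \<open>v\<close>.\<close>
  define e where "e = (\<lambda>xs. c xs + simplicial_boundary K (cone v d) xs)"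
  have "e = (\<lambda>xs. (c xs - cone v b xs) + d xs)"
    by (simp add: e_def d_cone fun_eq_iff)
  moreover have "d \<in> simplicial_chains (deletion K v) p"
    using d simplicial_chains_mono[OF link_subset_deletion] by blast
  ultimately have e: "e \<in> simplicial_chains (deletion K v) p"
    using simplicial_chains_add[OF deletion_part_chain[OF c, of v]] by (simp add: b_def)
  have "simplicial_boundary K e = (\<lambda>_. 0)"
    unfolding e_def simplicial_boundary_add simplicial_boundary_boundary[OF cone_d] by (simp add: dc)
  then have "e \<in> simplicial_boundaries (deletion K v) p"
    using e del simplicial_boundary_subcomplex[OF deletion_subset finite_vertices e]
    by (auto simp: homology_vanishes_def simplicial_cycles_def)
  then obtain f where f: "f \<in> simplicial_chains (deletion K v) (p + 1)"
    and ef: "e = simplicial_boundary K f"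
    using simplicial_boundary_subcomplex[OF deletion_subset finite_vertices]
    by (auto simp: simplicial_boundaries_def)
  have fK: "f \<in> simplicial_chains K (p + 1)"
    using f simplicial_chains_mono[OF deletion_subset] by blast
  have "c = simplicial_boundary K (\<lambda>xs. f xs - cone v d xs)"
    unfolding simplicial_boundary_diff ef[symmetric] e_def by simp
  then show "c \<in> simplicial_boundaries K p"
    unfolding simplicial_boundaries_def using simplicial_chains_diff[OF fK cone_d] by blast
qed

text \<open>For a cycle \<open>c\<close> with link part \<open>b\<close>, the part \<open>d\<close>
  away from \<open>v\<close> has boundary \<open>- b\<close>. By the cone formula the cone over
  \<open>d\<close> then has boundary \<open>d\<close> plus the cone over \<open>b\<close>, which is
  \<open>c\<close>.\<close>

lemma homology_vanishes_cone:
  assumes v: "{v} \<in> K" and apex: "\<And>A. A \<in> K \<Longrightarrow> insert v A \<in> K"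
  shows "homology_vanishes TYPE('k::field) K p"
  unfolding homology_vanishes_def
proof
  fix c :: "'a list \<Rightarrow> 'k" assume "c \<in> simplicial_cycles K p"
  then have c: "c \<in> simplicial_chains K p" and dc: "simplicial_boundary K c = (\<lambda>_. 0)"
    by (auto simp: simplicial_cycles_def)
  \<comment> \<open>Faces of \<open>c\<close> through \<open>v\<close> cannot be coned off, so only the part of \<open>c\<close> avoiding \<open>v\<close> is.\<close>
  define b d where "b = (\<lambda>ws. c (v # ws))" and "d = (\<lambda>xs. c xs - cone v b xs)"
  have db: "simplicial_boundary K b = (\<lambda>_. 0)"
    unfolding b_def boundary_link_part[OF c] by (simp add: dc)
  have bd: "simplicial_boundary K d = (\<lambda>ws. - b ws)"
    unfolding d_def simplicial_boundary_diff by (simp add: dc boundary_cone[OF v] db)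
  have "link K v = deletion K v"
    using link_subset_deletion apex by (auto simp: link_def deletion_def)
  then have "d \<in> simplicial_chains (link K v) p"
    using deletion_part_chain[OF c, of v] by (simp add: d_def b_def)
  then have "cone v d \<in> simplicial_chains K (p + 1)"
    by (rule cone_chain)
  moreover have "simplicial_boundary K (cone v d) = c"
    by (rule ext) (simp add: boundary_cone[OF v] bd cone_uminus, simp add: d_def)
  ultimately show "c \<in> simplicial_boundaries K p"
    unfolding simplicial_boundaries_def by blast
qed

end

section \<open>Passage between cycles and the quotient group\<close>

lemma trivial_group_reduced_homology:
  assumes K: "\<And>A B. A \<in> K \<Longrightarrow> B \<subseteq> A \<Longrightarrow> B \<in> K"
    and van: "homology_vanishes TYPE('k::field) K p"
  shows "trivial_group (reduced_homology K p :: ('a list \<Rightarrow> 'k) set monoid)"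
proof -
  let ?Z = "cycle_group K p :: ('a list \<Rightarrow> 'k) monoid"
  let ?B = "simplicial_boundaries K p :: ('a list \<Rightarrow> 'k) set"
  interpret H: comm_group "reduced_homology K p :: ('a list \<Rightarrow> 'k) set monoid"
    by (rule comm_group_reduced_homology[OF K])
  have add: "(\<lambda>xs. a xs + b xs) \<in> ?B" and diff: "(\<lambda>xs. a xs - b xs) \<in> ?B"
    if ab: "a \<in> ?B" "b \<in> ?B" for a b
  proof -
    obtain a' b' where "a' \<in> simplicial_chains K (p + 1)" "a = simplicial_boundary K a'"
      "b' \<in> simplicial_chains K (p + 1)" "b = simplicial_boundary K b'"
      using ab unfolding simplicial_boundaries_def by blast
    then show "(\<lambda>xs. a xs + b xs) \<in> ?B" "(\<lambda>xs. a xs - b xs) \<in> ?B"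
      using simplicial_chains_add[of a' K "p + 1" b'] simplicial_chains_diff[of a' K "p + 1" b']
      unfolding simplicial_boundaries_def
      by (simp_all only: simplicial_boundary_add[symmetric] simplicial_boundary_diff[symmetric] imageI)
  qed
  have "?B #>\<^bsub>?Z\<^esub> z = ?B" if "z \<in> carrier ?Z" for z
  proof -
    have z: "z \<in> ?B"
      using that van by (auto simp: cycle_group_def homology_vanishes_def)
    \<comment> \<open>Here \<open>b\<close> is written as \<open>(b - z) + z\<close>.\<close>
    have "b \<in> ?B #>\<^bsub>?Z\<^esub> z" if "b \<in> ?B" for b
      using diff[OF that z] unfolding r_coset_def cycle_group_def by force
    then show ?thesis
      using add[OF _ z] by (auto simp: r_coset_def cycle_group_def)
  qed
  then show ?thesis
    unfolding H.trivial_group_subset by (auto simp: reduced_homology_def carrier_FactGroup)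
qed

text \<open>Without vertices every boundary is 0, while the chain with value 1 on the empty simplex
  is a nonzero cycle. This makes the set whose maximum is the regularity nonempty.\<close>

lemma nontrivial_reduced_homology_empty:
  "\<not> trivial_group (reduced_homology {{}} (-1) :: ('a list \<Rightarrow> 'k::field) set monoid)"
proof
  let ?Z = "cycle_group {{}} (-1) :: ('a list \<Rightarrow> 'k) monoid"
  let ?B = "simplicial_boundaries {{}} (-1) :: ('a list \<Rightarrow> 'k) set"
  let ?c = "(\<lambda>xs. if xs = [] then 1 else 0) :: 'a list \<Rightarrow> 'k"
  assume "trivial_group (reduced_homology {{}} (-1) :: ('a list \<Rightarrow> 'k) set monoid)"
  then have "carrier (?Z Mod ?B) = {?B}"
    by (auto simp: trivial_group_def reduced_homology_def)
  moreover have "?c \<in> carrier ?Z"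
    by (auto simp: cycle_group_def simplicial_cycles_def simplicial_chains_iff alternating_def
        simplicial_boundary_def)
  ultimately have coset: "?B #>\<^bsub>?Z\<^esub> ?c = ?B"
    unfolding carrier_FactGroup by blast
  have "simplicial_boundary {{}} c = (\<lambda>_. 0)" for c :: "'a list \<Rightarrow> 'k"
    by (simp add: simplicial_boundary_def)
  then have B: "?B = {\<lambda>_. 0}"
    using simplicial_chains_zero[of "{{}}" 0] unfolding simplicial_boundaries_def by auto
  have "?c \<in> ?B #>\<^bsub>?Z\<^esub> ?c"
    unfolding B r_coset_def cycle_group_def by simp
  then have "?c = (\<lambda>_. 0)"
    unfolding coset unfolding B by (rule singletonD)
  then have "?c [] = 0" by (rule fun_cong)
  then show False by simp
qed


section \<open>Forests\<close>

text \<open>An edge from position \<open>k\<close> back to the start closes the initial segment of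
  the path; \<open>2 \<le> k\<close> gives it at least three vertices.\<close>

lemma is_cycle_take_path:
  assumes path: "\<And>i. Suc i < length xs \<Longrightarrow> {xs ! i, xs ! Suc i} \<in> E" and "distinct xs"
    and k: "2 \<le> k" "k < length xs" "{xs ! k, xs ! 0} \<in> E"
  shows "is_cycle E (take (Suc k) xs)"
  unfolding is_cycle_def
proof (intro conjI allI impI)
  fix i assume i: "i < length (take (Suc k) xs)"
  show "{take (Suc k) xs ! i, take (Suc k) xs ! (Suc i mod length (take (Suc k) xs))} \<in> E"
  proof (cases "i = k")
    case True
    then show ?thesis using k by (simp add: min_absorb2)
  next
    case False
    then show ?thesis using i k path[of i] by (simp add: min_absorb2)
  qed
qed (use assms in auto)

text \<open>The first vertex of a longest path is a leaf: a further neighbour on the path would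
  close a cycle, and one off the path would extend it.\<close>

lemma acyclic_graph_leaf:
  assumes S: "simple_graph S F" and ac: "acyclic_graph F" and "F \<noteq> {}"
  obtains x y where "x \<noteq> y" "{x, y} \<in> F" "\<And>z. {x, z} \<in> F \<Longrightarrow> z = y"
proof -
  define path where "path xs \<longleftrightarrow> distinct xs \<and> set xs \<subseteq> S \<and>
      (\<forall>i. Suc i < length xs \<longrightarrow> {xs ! i, xs ! Suc i} \<in> F)" for xs
  have edge: "a \<in> S" "b \<in> S" "a \<noteq> b" if "{a, b} \<in> F" for a b
  proof -
    have "{a, b} \<subseteq> S" "card {a, b} = 2"
      using S that unfolding simple_graph_def by blast+
    then show "a \<in> S" "b \<in> S" "a \<noteq> b" by auto
  qed
  have "length xs \<le> card S" if "path xs" for xs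
    using that S unfolding path_def simple_graph_def by (metis card_mono distinct_card)
  moreover obtain a b where ab: "{a, b} \<in> F"
    using \<open>F \<noteq> {}\<close> S unfolding simple_graph_def card_2_iff by (metis ex_in_conv)
  then have path_ab: "path [a, b]"
    using edge[OF ab] by (auto simp: path_def less_Suc_eq)
  \<comment> \<open>Paths have distinct vertices in \<open>S\<close>, so their lengths are bounded;
    \<open>Suc\<close> makes the bound strict.\<close>
  ultimately obtain xs where xs: "path xs" and max: "\<And>ys. path ys \<Longrightarrow> length ys \<le> length xs"
    using ex_has_greatest_nat[of path "[a, b]" length "Suc (card S)"] by (metis less_Suc_eq_le)
  have len: "2 \<le> length xs"
    using max[OF path_ab] by simp
  show thesis
  proof (rule that[of "xs ! 0" "xs ! 1"])
    show "{xs ! 0, xs ! 1} \<in> F"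
      using xs len by (auto simp: path_def)
    then show "xs ! 0 \<noteq> xs ! 1"
      by (rule edge)
    show "z = xs ! 1" if z: "{xs ! 0, z} \<in> F" for z
    proof (cases "z \<in> set xs")
      case True
      then obtain k where k: "k < length xs" "z = xs ! k"
        by (metis in_set_conv_nth)
      have "k \<noteq> 0"
        using edge(3)[OF z] k by metis
      moreover have "\<not> 2 \<le> k"
      proof
        assume "2 \<le> k"
        then have "is_cycle F (take (Suc k) xs)"
          using xs k z by (intro is_cycle_take_path) (auto simp: path_def insert_commute)
        then show False using ac by (auto simp: acyclic_graph_def)
      qed
      ultimately have "k = 1" by linarith
      then show ?thesis using k by simp
    next
      case False
      have "{(z # xs) ! i, (z # xs) ! Suc i} \<in> F" if "Suc i < length (z # xs)" for i
        using that xs z by (cases i) (auto simp: path_def insert_commute)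
      then have "path (z # xs)"
        using False xs edge(2)[OF z] by (auto simp: path_def)
      then show ?thesis using max[of "z # xs"] by simp
    qed
  qed
qed


section \<open>Homology of independence complexes\<close>

lemma finite_complex_independence: "finite S \<Longrightarrow> finite_complex (independence_complex S E)"
  by standard (auto simp: independence_complex_def intro: finite_subset, blast)

lemma deletion_independence_complex:
  "deletion (independence_complex S E) v = independence_complex (S - {v}) E"
  by (auto simp: deletion_def independence_complex_def)

text \<open>An edge inside \<open>insert v A\<close> but not inside \<open>A\<close> joins
  \<open>v\<close> to a neighbour in \<open>A\<close>, so exactly the closed neighbourhood of
  \<open>v\<close> has to be removed.\<close>

lemma link_independence_complex:
  assumes E: "\<forall>e\<in>E. card e = 2" and "v \<in> S"
  shows "link (independence_complex S E) v = independence_complex (S - {u. u = v \<or> {u, v} \<in> E}) E"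
proof (intro Set.set_eqI iffI)
  fix A assume "A \<in> link (independence_complex S E) v"
  then show "A \<in> independence_complex (S - {u. u = v \<or> {u, v} \<in> E}) E"
    by (auto simp: link_def independence_complex_def)
next
  fix A assume A: "A \<in> independence_complex (S - {u. u = v \<or> {u, v} \<in> E}) E"
  have "\<not> e \<subseteq> insert v A" if e: "e \<in> E" for e
  proof
    assume sub: "e \<subseteq> insert v A"
    have "\<not> e \<subseteq> A" using A e by (auto simp: independence_complex_def)
    then have "v \<in> e" using sub by auto
    then obtain u where "e = {u, v}" "u \<noteq> v"
      using E e by (metis card_2_iff doubleton_eq_iff insertE singletonD)
    then show False
      using sub e A by (auto simp: independence_complex_def)
  qed
  then show "A \<in> link (independence_complex S E) v"
    using A \<open>v \<in> S\<close> by (auto simp: link_def independence_complex_def)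
qed

lemma singleton_in_independence_complex:
  assumes E: "\<forall>e\<in>E. card e = 2" and "v \<in> S"
  shows "{v} \<in> independence_complex S E"
proof -
  have "\<not> e \<subseteq> {v}" if "e \<in> E" for e
    using E that card_mono[of "{v}" e] by fastforce
  then show ?thesis using \<open>v \<in> S\<close> by (auto simp: independence_complex_def)
qed

text \<open>The closed neighbourhood of \<open>x\<close> in \<open>S\<close> is \<open>{x}\<close>,
  so link and deletion agree and the complex is a cone with apex \<open>x\<close>.\<close>

lemma homology_vanishes_isolated_vertex:
  assumes E: "\<forall>e\<in>E. card e = 2" and S: "finite S" "x \<in> S" and iso: "\<And>u. u \<in> S \<Longrightarrow> {u, x} \<notin> E"
  shows "homology_vanishes TYPE('k::field) (independence_complex S E) p"
proof -
  interpret finite_complex "independence_complex S E"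
    using S by (intro finite_complex_independence)
  have "S - {u. u = x \<or> {u, x} \<in> E} = S - {x}"
    using iso by auto
  then have "link (independence_complex S E) x = deletion (independence_complex S E) x"
    by (simp add: link_independence_complex[OF E S(2)] deletion_independence_complex)
  then have "insert x A \<in> independence_complex S E" if "A \<in> independence_complex S E" for A
    using that by (cases "x \<in> A") (auto simp: link_def deletion_def insert_absorb)
  then show ?thesis
    using singleton_in_independence_complex[OF E S(2)] by (intro homology_vanishes_cone) auto
qed

lemma homology_vanishes_vertex:
  assumes E: "\<forall>e\<in>E. card e = 2" and S: "finite S" "v \<in> S"
    and "homology_vanishes TYPE('k::field) (independence_complex (S - {v}) E) p"
    and "homology_vanishes TYPE('k)
           (independence_complex (S - {u. u = v \<or> {u, v} \<in> E}) E) (p - 1)"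
  shows "homology_vanishes TYPE('k) (independence_complex S E) p"
proof -
  interpret finite_complex "independence_complex S E"
    using S by (intro finite_complex_independence)
  show ?thesis
  proof (rule homology_vanishes_deletion_link)
    show "{v} \<in> independence_complex S E"
      by (rule singleton_in_independence_complex[OF E S(2)])
    show "homology_vanishes TYPE('k) (deletion (independence_complex S E) v) p"
      unfolding deletion_independence_complex by (rule assms(4))
    show "homology_vanishes TYPE('k) (link (independence_complex S E) v) (p - 1)"
      unfolding link_independence_complex[OF E S(2)] by (rule assms(5))
  qed
qed

text \<open>No face has a vertex, whereas a simplex of dimension \<open>p \<ge> 0\<close> has at
  least one, so the only chain is 0.\<close>

lemma homology_vanishes_empty_vertices:
  assumes "0 \<le> p"
  shows "homology_vanishes TYPE('k::field) (independence_complex {} E) p"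
proof -
  have "c = (\<lambda>_. 0)" if "c \<in> simplicial_cycles (independence_complex {} E) p"
    for c :: "'a list \<Rightarrow> 'k"
  proof
    fix xs
    have c: "c \<in> simplicial_chains (independence_complex {} E) p"
      using that by (simp add: simplicial_cycles_def)
    show "c xs = 0"
      using simplicial_chainsD(2,3)[OF c, of xs] \<open>0 \<le> p\<close>
      by (force simp: independence_complex_def)
  qed
  moreover have "(\<lambda>_. 0) \<in> simplicial_boundaries (independence_complex {} E) p"
    unfolding simplicial_boundaries_def
    by (rule image_eqI[of _ _ "\<lambda>_. 0"]) (simp_all add: simplicial_boundary_def simplicial_chains_zero)
  ultimately show ?thesis unfolding homology_vanishes_def by blast
qed

section \<open>Induction over forests and decycling sets\<close>

lemma acyclic_graph_mono: "acyclic_graph F \<Longrightarrow> F' \<subseteq> F \<Longrightarrow> acyclic_graph F'"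
  unfolding acyclic_graph_def is_cycle_def by blast

lemma induced_edges_mono: "S \<subseteq> T \<Longrightarrow> induced_edges E S \<subseteq> induced_edges E T"
  unfolding induced_edges_def by blast

text \<open>An edge within the enlarged vertex set either meets \<open>{x, y}\<close>, and then
  equals it, or lies in \<open>\<Union>M\<close>, and then belongs to \<open>M\<close>.\<close>

lemma induced_matching_insert:
  assumes M: "induced_matching E M" and "{x, y} \<in> E"
    and nbrs: "\<And>e. e \<in> E \<Longrightarrow> e \<subseteq> insert x (insert y (\<Union>M)) \<Longrightarrow> e \<inter> {x, y} \<noteq> {} \<Longrightarrow> e = {x, y}"
    and disj: "x \<notin> \<Union>M" "y \<notin> \<Union>M"
  shows "induced_matching E (insert {x, y} M)"
proof -
  have "induced_edges E (\<Union>(insert {x, y} M)) \<subseteq> insert {x, y} M"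
  proof
    fix e assume "e \<in> induced_edges E (\<Union>(insert {x, y} M))"
    then have e: "e \<in> E" "e \<subseteq> insert x (insert y (\<Union>M))"
      by (auto simp: induced_edges_def)
    show "e \<in> insert {x, y} M"
    proof (cases "e \<inter> {x, y} = {}")
      case True
      then have "e \<in> induced_edges E (\<Union>M)"
        using e by (auto simp: induced_edges_def)
      then show ?thesis using M by (simp add: induced_matching_def)
    qed (use nbrs e in blast)
  qed
  moreover have "insert {x, y} M \<subseteq> E"
    using M assms(2) by (simp add: induced_matching_def)
  then have "insert {x, y} M \<subseteq> induced_edges E (\<Union>(insert {x, y} M))"
    by (auto simp: induced_edges_def)
  ultimately have "induced_edges E (\<Union>(insert {x, y} M)) = insert {x, y} M"
    by (rule subset_antisym)
  moreover have "\<forall>e\<in>M. {x, y} \<inter> e = {} \<and> e \<inter> {x, y} = {}"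
    using disj by auto
  ultimately show ?thesis
    using M \<open>insert {x, y} M \<subseteq> E\<close> unfolding induced_matching_def by simp
qed

text \<open>Induction on the number of vertices, with \<open>p\<close> varying since the link lowers
  the degree. The edge set stays fixed: whether a matching is induced depends only on the edges
  among its own vertices, so subgraphs are described by
  \<open>\<Union>M \<subseteq> S\<close>.\<close>

lemma homology_vanishes_forest:
  assumes E: "\<forall>e\<in>E. card e = 2" and "finite S" "acyclic_graph (induced_edges E S)"
    and "\<And>M. induced_matching E M \<Longrightarrow> \<Union>M \<subseteq> S \<Longrightarrow> int (card M) \<le> p"
  shows "homology_vanishes TYPE('k::field) (independence_complex S E) p"
  using assms(2-4)
proof (induction "card S" arbitrary: S p rule: less_induct)
  case less
  show ?case
  proof (cases "induced_edges E S = {}")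
    case True
    show ?thesis
    proof (cases "S = {}")
      case True
      \<comment> \<open>The empty matching excludes degree -1, in which the complex
        \<open>{{}}\<close> has nonzero homology.\<close>
      have "induced_matching E {}"
        using E by (auto simp: induced_matching_def induced_edges_def)
      then have "0 \<le> p"
        using less.prems(3)[of "{}"] by simp
      then show ?thesis
        unfolding True by (rule homology_vanishes_empty_vertices)
    next
      case False
      then obtain x where "x \<in> S" by blast
      then show ?thesis
        using True by (intro homology_vanishes_isolated_vertex[OF E less.prems(1)])
          (auto simp: induced_edges_def)
    qed
  next
    case False
    have "simple_graph S (induced_edges E S)"
      using E less.prems(1) by (auto simp: simple_graph_def induced_edges_def)
    then obtain x y where xy: "x \<noteq> y" "{x, y} \<in> induced_edges E S"
      and leaf: "\<And>z. {x, z} \<in> induced_edges E S \<Longrightarrow> z = y"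
      using acyclic_graph_leaf less.prems(2) False by metis
    then have S: "x \<in> S" "y \<in> S" and xyE: "{x, y} \<in> E"
      by (auto simp: induced_edges_def)
    have leaf': "z = y" if "{x, z} \<in> E" "z \<in> S" for z
      using leaf[of z] that S by (simp add: induced_edges_def)
    let ?T = "S - {u. u = y \<or> {u, y} \<in> E}"
    show ?thesis
    proof (rule homology_vanishes_vertex[OF E less.prems(1) S(2)])
      show "homology_vanishes TYPE('k) (independence_complex (S - {y}) E) p"
        using less.prems(1) S xy(1) leaf'
        by (intro homology_vanishes_isolated_vertex[OF E, of _ x]) (auto simp: insert_commute)
      show "homology_vanishes TYPE('k) (independence_complex ?T E) (p - 1)"
      proof (rule less.hyps)
        show "card ?T < card S"
          using S less.prems(1) by (intro psubset_card_mono) auto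
        show "finite ?T" using less.prems(1) by simp
        show "acyclic_graph (induced_edges E ?T)"
          using less.prems(2) by (rule acyclic_graph_mono) (intro induced_edges_mono, auto)
        fix M assume M: "induced_matching E M" "\<Union>M \<subseteq> ?T"
        have disj: "x \<notin> \<Union>M" "y \<notin> \<Union>M"
          using M(2) xyE by auto
        \<comment> \<open>An edge at the leaf \<open>x\<close> ends in \<open>y\<close>. An edge at
          \<open>y\<close> ends in a neighbour of \<open>y\<close>, hence outside \<open>?T\<close>
          and so outside \<open>\<Union>M\<close>, which leaves only \<open>x\<close>.\<close>
        have "induced_matching E (insert {x, y} M)"
        proof (rule induced_matching_insert[OF M(1) xyE _ disj])
          fix e assume e: "e \<in> E" "e \<subseteq> insert x (insert y (\<Union>M))" "e \<inter> {x, y} \<noteq> {}"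
          have eS: "e \<subseteq> S" using e(2) M(2) S by blast
          obtain a b where ab: "e = {a, b}" "a \<in> {x, y}" "a \<noteq> b"
            using E e(1,3) by (metis Int_emptyI card_2_iff doubleton_eq_iff insertE singletonD)
          show "e = {x, y}"
          proof (cases "a = x")
            case True
            then show ?thesis using leaf'[of b] ab e(1) eS by auto
          next
            case False
            then have a: "a = y" using ab by auto
            then have "b \<notin> ?T" using ab e(1) by (simp add: insert_commute)
            then have "b = x" using ab a e(2) M(2) by blast
            then show ?thesis using ab a by auto
          qed
        qed
        moreover have "\<Union>(insert {x, y} M) \<subseteq> S"
          using M(2) S by auto
        ultimately have "int (card (insert {x, y} M)) \<le> p"
          by (rule less.prems(3))
        moreover have "finite M"
          using M(2) less.prems(1) by (meson finite_Diff finite_UnionD finite_subset)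
        moreover have "{x, y} \<notin> M"
          using disj by auto
        ultimately show "int (card M) \<le> p - 1" by simp
      qed
    qed
  qed
qed

text \<open>Removing \<open>v\<close> from \<open>D\<close> lowers the bound by one, which pays for
  the degree lost in the link. \<open>D\<close> need not lie in \<open>S\<close>, so the same set
  serves all smaller vertex sets.\<close>

lemma homology_vanishes_decycling:
  assumes E: "\<forall>e\<in>E. card e = 2" and "finite D" "finite S"
    and "acyclic_graph (induced_edges E (S - D))"
    and "\<And>M. induced_matching E M \<Longrightarrow> \<Union>M \<subseteq> S \<Longrightarrow> int (card M + card D) \<le> p"
  shows "homology_vanishes TYPE('k::field) (independence_complex S E) p"
  using assms(2-5)
proof (induction D arbitrary: S p rule: finite_induct)
  case empty
  then show ?case by (intro homology_vanishes_forest[OF E]) auto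
next
  case (insert v D)
  \<comment> \<open>Covers the deletion with \<open>q = p\<close>, the link with
    \<open>q = p - 1\<close>, and \<open>S\<close> itself when \<open>v\<close> is not in
    it.\<close>
  have sub: "homology_vanishes TYPE('k) (independence_complex T E) q"
    if T: "T \<subseteq> S" "v \<notin> T" and q: "p - 1 \<le> q" for T q
  proof (rule insert.IH)
    show "finite T" using T insert.prems(1) finite_subset by blast
    show "acyclic_graph (induced_edges E (T - D))"
      using insert.prems(2) by (rule acyclic_graph_mono) (intro induced_edges_mono, use T in auto)
    show "int (card M + card D) \<le> q" if "induced_matching E M" "\<Union>M \<subseteq> T" for M
      using insert.prems(3)[OF that(1)] that(2) T q insert.hyps by force
  qed
  show ?case
  proof (cases "v \<in> S")
    case True
    then show ?thesis
      by (intro homology_vanishes_vertex[OF E insert.prems(1)] sub) auto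
  next
    case False
    then show ?thesis by (intro sub) auto
  qed
qed

theorem theorem4p11:
  fixes V :: "'a set" and E :: "'a set set"
  assumes "simple_graph V E"
  shows "regularity TYPE('k::field) V E \<le> induced_matching_number E + decycling_number V E"
proof -
  have V: "finite V" and E: "\<forall>e\<in>E. card e = 2" and EV: "E \<subseteq> Pow V"
    using assms by (auto simp: simple_graph_def)
  have "finite E" using EV V by (meson finite_Pow_iff finite_subset)
  then have "finite {M. induced_matching E M}"
    by (rule finite_subset[rotated, OF finite_Pow_iff[THEN iffD2]]) (auto simp: induced_matching_def)
  then have im: "card M \<le> induced_matching_number E" if "induced_matching E M" for M
    unfolding induced_matching_number_def using that by (intro Max_ge) auto
  \<comment> \<open>The whole vertex set is decycling, so the minimum is taken over a nonempty set
    and is attained.\<close>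
  have "acyclic_graph {}"
    by (force simp: acyclic_graph_def is_cycle_def)
  moreover have "induced_edges E (V - V) = {}"
    using E by (auto simp: induced_edges_def)
  ultimately have "decycling_set V E V"
    by (simp add: decycling_set_def)
  moreover have "finite {D. decycling_set V E D}"
    by (rule finite_subset[of _ "Pow V"]) (use V in \<open>auto simp: decycling_set_def\<close>)
  ultimately have "decycling_number V E \<in> card ` {D. decycling_set V E D}"
    unfolding decycling_number_def by (intro Min_in) auto
  then obtain D where D: "decycling_set V E D" and cardD: "card D = decycling_number V E"
    by auto
  then have "D \<subseteq> V" and acD: "acyclic_graph (induced_edges E (V - D))"
    by (auto simp: decycling_set_def)
  then have "finite D" using V finite_subset by blast
  let ?b = "induced_matching_number E + decycling_number V E"
  let ?H = "\<lambda>S j. reduced_homology (induced_subcomplex (independence_complex V E) S) (int j - 1)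
      :: ('a list \<Rightarrow> 'k) set monoid"
  let ?R = "{j. \<exists>S\<subseteq>V. \<not> trivial_group (?H S j)}"
  \<comment> \<open>Besides the estimate, this gives the finiteness that \<open>Max\<close>
    requires.\<close>
  have bound: "j \<le> ?b" if R: "j \<in> ?R" for j
  proof (rule ccontr)
    assume j: "\<not> j \<le> ?b"
    obtain S where S: "S \<subseteq> V" and nt: "\<not> trivial_group (?H S j)"
      using R by blast
    have ind: "induced_subcomplex (independence_complex V E) S = independence_complex S E"
      using S by (auto simp: induced_subcomplex_def independence_complex_def)
    have "homology_vanishes TYPE('k) (independence_complex S E) (int j - 1)"
    proof (rule homology_vanishes_decycling[OF E \<open>finite D\<close>])
      show "finite S" using S V finite_subset by blast
      show "acyclic_graph (induced_edges E (S - D))"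
        using acD by (rule acyclic_graph_mono) (intro induced_edges_mono, use S in auto)
      \<comment> \<open>The strict inequality \<open>j > ?b\<close> absorbs the shift from
        \<open>j\<close> to homological degree \<open>j - 1\<close>.\<close>
      show "int (card M + card D) \<le> int j - 1" if "induced_matching E M" for M
        using im[OF that] j cardD by linarith
    qed
    then have "trivial_group (?H S j)"
      unfolding ind
      using finite_complex.face_subset[OF finite_complex_independence[OF finite_subset[OF S V]]]
      by (intro trivial_group_reduced_homology)
    then show False using nt by simp
  qed
  have "induced_subcomplex (independence_complex V E) {} = {{}}"
    using E by (auto simp: induced_subcomplex_def independence_complex_def)
  then have "\<not> trivial_group (?H {} 0)"
    using nontrivial_reduced_homology_empty by simp
  then have "?R \<noteq> {}" by blast
  moreover have "finite ?R"
    using bound by (meson finite_nat_set_iff_bounded_le)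
  ultimately show ?thesis
    unfolding regularity_def using bound by (intro Max.boundedI)
qed

end
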